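(* Let $f:\mathbb{R}\to\mathbb{R}$ and $g:\mathbb{R}\to\mathbb{R}$ be smooth functions, with $g$ monotonically increasing in the sense that $g'(\xi)>0$ for all $\xi\in\mathbb{R}$. For $a>0$ let $g_a(x)=g(x/a)$. Suppose there are functions $g_+$ and $g_-$, smooth up to the boundary $x=0$ on $[0,\infty)$ and $(-\infty,0]$ respectively, such that as $a\to0^+$, $g_a(x)\to g_0(x)$ pointwise for $x\neq 0$, where $$g_0(x)=\begin{cases} g_+(x), & x>0,\\ g_-(x), & x<0.\end{cases}$$ Write $g_0(x)=\lambda g_+(x)+(1-\lambda)g_-(x)$, where $\lambda=1$ for $x>0$ and $\lambda=0$ for $x<0$ (and, on $x=0$, the Filippov convention $\lambda\in[0,1]$ is used). Assume that $g_-(0)<f(0)<g_+(0)$. Then for all sufficiently small $a>0$ the system $$\dot x=y-g_a(x),\qquad \dot y=y-f(x)$$ has a saddle equilibrium point $p_a=(x_a,y_a)$, and these can be chosen such that $x_a\to0$ as $a\to0^+$. When $a=0$, the nonsmooth system $$\dot x=y-g_0(x),\qquad \dot y=y-f(x)$$ has a pseudoequilibrium on the splitting manifold $\{x=0\}$ that lies in a stable (attracting) sliding region and is unstable for the sliding flow, and stable and unstable manifolds of this pseudoequilibrium exist locally (in the sense defined in the context).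
   Context: Saddle: an equilibrium of a smooth planar system at which the Jacobian has negative determinant (real eigenvalues of opposite sign). Nonsmooth system: the system with $a=0$ is a piecewise-smooth planar system with splitting manifold $\{x=0\}$ (defined by $h(x,y)=x=0$). It is written as the convex combination $\mathbf{f}(\mathbf{x},\lambda)=\lambda f^+(\mathbf{x})+(1-\lambda)f^-(\mathbf{x})$, where $f^+$ is the vector field in $x>0$ (obtained by replacing $g_0$ by $g_+$) and $f^-$ is the vector field in $x<0$ (obtained by replacing $g_0$ by $g_-$), with $\lambda=1$ for $x>0$, $\lambda=0$ for $x<0$, and $\lambda\in[0,1]$ on $x=0$. Both $f^\pm$ extend smoothly up to $x=0$. Sliding: let $S(\mathbf{x},\lambda)=\mathbf{f}(\mathbf{x},\lambda)\cdot\nabla h(\mathbf{x})$. The sliding region is the set of points of $\{x=0\}$ at which $S=0$ can be solved for some $\lambda\in[0,1]$. The sliding flow is the flow on the sliding region obtained by substituting this $\lambda$ into $\dot{\mathbf{x}}=\mathbf{f}(\mathbf{x},\lambda)$. The sliding region is attracting (stable) if $\frac{dS}{d\lambda}<0$ along it, and repelling (unstable) if $\frac{dS}{d\lambda}>0$ along it. Pseudoequilibrium: an equilibrium of the Filippov (sliding) flow on $\{x=0\}$, i.e. a point $p$ with $x=0$ at which $\lambda f^+(p)+(1-\lambda)f^-(p)=0$ for some $\lambda\in[0,1]$, although $f^\pm(p)\neq0$. Its stability refers to its stability as an equilibrium of the one-dimensional sliding flow. Local stable and unstable manifolds (nonsmooth analogue in this case): a local unstable manifold of the pseudoequilibrium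 $p$ is a relatively open interval of the sliding region in $\{x=0\}$ containing $p$, all of whose points tend to $p$ under the sliding flow as $t\to-\infty$. A local stable manifold consists of $p$ together with two trajectories arriving at $p$ in finite forward time, one in $\{x<0\}$ (a solution of $f^-$) and one in $\{x>0\}$ (a solution of $f^+$), the one on each side being unique. *)

theory Defs
  imports "HOL-Analysis.Analysis"
begin

text \<open>A function is smooth on \<open>S\<close> if it has derivatives of all orders on \<open>S\<close>. Derivatives are taken
  within \<open>S\<close>, so for \<open>S = {0..}\<close> and \<open>S = {..0}\<close> they are one-sided at \<open>0\<close> (smooth up to the
  boundary), and the values of the function outside \<open>S\<close> play no role.\<close>

definition smooth_fun_on :: "real set \<Rightarrow> (real \<Rightarrow> real) \<Rightarrow> bool" where
  "smooth_fun_on S u \<longleftrightarrow>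
     (\<exists>D :: nat \<Rightarrow> real \<Rightarrow> real. (\<forall>x\<in>S. D 0 x = u x) \<and>
        (\<forall>n. \<forall>x\<in>S. (D n has_real_derivative D (Suc n) x) (at x within S)))"

definition lienard_field :: "(real \<Rightarrow> real) \<Rightarrow> (real \<Rightarrow> real) \<Rightarrow> real^2 \<Rightarrow> real^2" where
  "lienard_field f G p = vector [p$2 - G (p$1), p$2 - f (p$1)]"

definition saddle :: "(real^2 \<Rightarrow> real^2) \<Rightarrow> real^2 \<Rightarrow> bool" where
  "saddle F p \<longleftrightarrow> F p = 0 \<and> F differentiable (at p) \<and> det (jacobian F (at p)) < 0"


subsection \<open>Piecewise-smooth planar systems with splitting manifold \<open>{x = 0}\<close>\<close>

text \<open>Throughout, \<open>Fp\<close> and \<open>Fm\<close> are the vector fields in \<open>x > 0\<close> and \<open>x < 0\<close>, extended to \<open>x = 0\<close>.\<close>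

definition switch_fun :: "real^2 \<Rightarrow> real" where
  "switch_fun p = p$1"

definition switch_grad :: "real^2" where
  "switch_grad = vector [1, 0]"

lemma GDERIV_switch_fun: "GDERIV switch_fun p :> switch_grad"
proof -
  have "switch_fun = (\<lambda>q. q \<bullet> switch_grad)"
    by (auto simp: fun_eq_iff switch_fun_def switch_grad_def inner_vec_def sum_2)
  moreover have "((\<lambda>q. q \<bullet> switch_grad) has_derivative (\<lambda>q. q \<bullet> switch_grad)) (at p)"
    by (intro derivative_intros)
  ultimately show ?thesis
    by (simp add: gderiv_def)
qed

definition convex_field ::
  "(real^2 \<Rightarrow> real^2) \<Rightarrow> (real^2 \<Rightarrow> real^2) \<Rightarrow> real \<Rightarrow> real^2 \<Rightarrow> real^2" where
  "convex_field Fp Fm l p = l *\<^sub>R Fp p + (1 - l) *\<^sub>R Fm p"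

definition sliding_fun ::
  "(real^2 \<Rightarrow> real^2) \<Rightarrow> (real^2 \<Rightarrow> real^2) \<Rightarrow> real^2 \<Rightarrow> real \<Rightarrow> real" where
  "sliding_fun Fp Fm p l = convex_field Fp Fm l p \<bullet> switch_grad"

definition sliding_region ::
  "(real^2 \<Rightarrow> real^2) \<Rightarrow> (real^2 \<Rightarrow> real^2) \<Rightarrow> (real^2) set" where
  "sliding_region Fp Fm = {p. switch_fun p = 0 \<and> (\<exists>l\<in>{0..1}. sliding_fun Fp Fm p l = 0)}"

definition attracting_sliding ::
  "(real^2 \<Rightarrow> real^2) \<Rightarrow> (real^2 \<Rightarrow> real^2) \<Rightarrow> bool" where
  "attracting_sliding Fp Fm \<longleftrightarrow>
     (\<forall>p\<in>sliding_region Fp Fm. \<forall>l\<in>{0..1}.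
        sliding_fun Fp Fm p l = 0 \<longrightarrow> deriv (sliding_fun Fp Fm p) l < 0)"

definition sliding_solution ::
  "(real^2 \<Rightarrow> real^2) \<Rightarrow> (real^2 \<Rightarrow> real^2) \<Rightarrow> (real \<Rightarrow> real^2) \<Rightarrow> real set \<Rightarrow> bool" where
  "sliding_solution Fp Fm \<phi> I \<longleftrightarrow>
     (\<forall>t\<in>I. switch_fun (\<phi> t) = 0 \<and>
        (\<exists>l\<in>{0..1}. sliding_fun Fp Fm (\<phi> t) l = 0 \<and>
           (\<phi> has_vector_derivative convex_field Fp Fm l (\<phi> t)) (at t within I)))"

definition pseudoequilibrium ::
  "(real^2 \<Rightarrow> real^2) \<Rightarrow> (real^2 \<Rightarrow> real^2) \<Rightarrow> real^2 \<Rightarrow> bool" where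
  "pseudoequilibrium Fp Fm p \<longleftrightarrow>
     switch_fun p = 0 \<and> (\<exists>l\<in>{0..1}. convex_field Fp Fm l p = 0) \<and> Fp p \<noteq> 0 \<and> Fm p \<noteq> 0"

text \<open>Lyapunov stability with respect to the one-dimensional sliding flow only.\<close>

definition sliding_stable ::
  "(real^2 \<Rightarrow> real^2) \<Rightarrow> (real^2 \<Rightarrow> real^2) \<Rightarrow> real^2 \<Rightarrow> bool" where
  "sliding_stable Fp Fm p \<longleftrightarrow>
     (\<forall>\<epsilon>>0. \<exists>\<delta>>0. \<forall>T\<ge>0. \<forall>\<phi>. sliding_solution Fp Fm \<phi> {0..T} \<and> dist (\<phi> 0) p < \<delta> \<longrightarrow>
        (\<forall>t\<in>{0..T}. dist (\<phi> t) p < \<epsilon>))"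

text \<open>The set \<open>U\<close> lies on the line \<open>{x = 0}\<close>, so there being an interval means being connected. The
  last conjunct demands that a backward sliding solution through each point of \<open>U\<close> exists and that
  every such solution tends to \<open>p\<close>.\<close>

definition local_unstable_manifold ::
  "(real^2 \<Rightarrow> real^2) \<Rightarrow> (real^2 \<Rightarrow> real^2) \<Rightarrow> real^2 \<Rightarrow> (real^2) set \<Rightarrow> bool" where
  "local_unstable_manifold Fp Fm p U \<longleftrightarrow>
     p \<in> U \<and> openin (top_of_set (sliding_region Fp Fm)) U \<and> connected U \<and>
     (\<forall>q\<in>U. (\<exists>\<phi>. sliding_solution Fp Fm \<phi> {..0} \<and> \<phi> 0 = q) \<and>
            (\<forall>\<phi>. sliding_solution Fp Fm \<phi> {..0} \<and> \<phi> 0 = q \<longrightarrow> (\<phi> \<longlongrightarrow> p) at_bot))"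

text \<open>A trajectory of \<open>F\<close> in the region \<open>A\<close> on the time interval \<open>[-T, 0)\<close> that arrives at \<open>p\<close>; as
  the systems are autonomous, the arrival time is normalised to be \<open>0\<close>.\<close>

definition arriving_trajectory ::
  "(real^2 \<Rightarrow> real^2) \<Rightarrow> (real^2) set \<Rightarrow> real^2 \<Rightarrow> real \<Rightarrow> (real \<Rightarrow> real^2) \<Rightarrow> bool" where
  "arriving_trajectory F A p T \<gamma> \<longleftrightarrow>
     T > 0 \<and> continuous_on {-T..0} \<gamma> \<and> \<gamma> 0 = p \<and>
     (\<forall>t\<in>{-T..<0}. \<gamma> t \<in> A \<and> (\<gamma> has_vector_derivative F (\<gamma> t)) (at t within {-T..<0}))"

text \<open>Trajectories are unique up to the choice of how far back in time they are followed.\<close>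

definition unique_arriving_trajectory ::
  "(real^2 \<Rightarrow> real^2) \<Rightarrow> (real^2) set \<Rightarrow> real^2 \<Rightarrow> real \<Rightarrow> (real \<Rightarrow> real^2) \<Rightarrow> bool" where
  "unique_arriving_trajectory F A p T \<gamma> \<longleftrightarrow>
     arriving_trajectory F A p T \<gamma> \<and>
     (\<forall>T' \<gamma>'. arriving_trajectory F A p T' \<gamma>' \<longrightarrow> (\<forall>t\<in>{- min T T'..0}. \<gamma>' t = \<gamma> t))"

definition local_stable_manifold ::
  "(real^2 \<Rightarrow> real^2) \<Rightarrow> (real^2 \<Rightarrow> real^2) \<Rightarrow> real^2 \<Rightarrow> (real^2) set \<Rightarrow> bool" where
  "local_stable_manifold Fp Fm p W \<longleftrightarrow>
     (\<exists>Tm \<gamma>m Tp \<gamma>p.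
        unique_arriving_trajectory Fm {q. switch_fun q < 0} p Tm \<gamma>m \<and>
        unique_arriving_trajectory Fp {q. switch_fun q > 0} p Tp \<gamma>p \<and>
        W = {p} \<union> \<gamma>m ` {-Tm..<0} \<union> \<gamma>p ` {-Tp..<0})"

end

theory Submission
  imports Defs
begin

text \<open>The scaling \<open>g (x / a)\<close> forgets everything about \<open>g\<close> except its limits at \<open>\<plusminus>\<infinity>\<close>: for
  \<open>x > 0\<close> the argument tends to \<open>\<infinity>\<close>, whatever \<open>x\<close> is. So \<open>gp\<close> and \<open>gm\<close> are constant on their
  half-lines (\<open>scaling_limit_constant\<close>), with \<open>gp 0\<close> and \<open>gm 0\<close> the limits of \<open>g\<close> at \<open>\<plusminus>\<infinity>\<close>. As
  \<open>f 0\<close> lies strictly between them, \<open>g \<xi>\<^sub>0 = f 0\<close> for some \<open>\<xi>\<^sub>0\<close>.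

  In the stretched variable \<open>\<xi> = x / a\<close> the equilibria of the smooth system solve
  \<open>g \<xi> = f (a * \<xi>)\<close>, a small perturbation of \<open>g \<xi> = f 0\<close>. The intermediate value theorem gives a
  solution within distance \<open>1\<close> of \<open>\<xi>\<^sub>0\<close>, so \<open>x = a * \<xi>\<close> tends to \<open>0\<close>. The Jacobian determinant is
  \<open>f' x - g' \<xi> / a\<close>, whose second term tends to \<open>-\<infinity>\<close> while the first stays bounded
  (\<open>saddle_family\<close>).

  For the nonsmooth system, sliding takes place on the segment \<open>gm 0 \<le> y \<le> gp 0\<close> of the \<open>y\<close>-axis and
  is governed by the linear equation \<open>y' = y - f 0\<close>. Its solutions \<open>f 0 + k * exp t\<close> move away from
  \<open>(0, f 0)\<close>, and backward in time they tend to it, so the open segment is an unstable manifold.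

  On either side of the axis the field is \<open>(y - c, y - f x)\<close> with \<open>c\<close> constant, and it extends across
  the axis by the same formula. The extended field is locally Lipschitz and transverse to the axis
  at \<open>(0, f 0)\<close>, because \<open>f 0 \<noteq> c\<close>. The stable manifold consists of its backward solutions from
  that point: existence is a Picard iteration (\<open>picard_backward_local\<close>), uniqueness a Gronwall
  estimate (\<open>backward_uniqueness\<close>), and transversality together with the sign of \<open>f 0 - c\<close> puts them
  on the correct side (\<open>ex_unique_arriving_trajectory\<close>).\<close>

section \<open>Consequences of smoothness\<close>

lemma smooth_fun_on_UNIV_C1:
  assumes "smooth_fun_on UNIV u"
  obtains u' where "\<And>x. (u has_real_derivative u' x) (at x)" "continuous_on UNIV u'"
proof -
  obtain D :: "nat \<Rightarrow> real \<Rightarrow> real" where D: "\<And>x. D 0 x = u x"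
      "\<And>n x. (D n has_real_derivative D (Suc n) x) (at x)"
    using assms unfolding smooth_fun_on_def by auto
  have "D 0 = u" using D(1) by blast
  then have "(u has_real_derivative D 1 x) (at x)" for x
    using D(2)[of 0 x] by simp
  moreover have "continuous_on UNIV (D 1)"
    using D(2) by (meson DERIV_isCont continuous_at_imp_continuous_on)
  ultimately show thesis by (rule that)
qed

lemma smooth_fun_on_imp_continuous_on:
  assumes "smooth_fun_on S u"
  shows "continuous_on S u"
proof -
  obtain D :: "nat \<Rightarrow> real \<Rightarrow> real" where D: "\<And>x. x \<in> S \<Longrightarrow> D 0 x = u x"
      "\<And>n x. x \<in> S \<Longrightarrow> (D n has_real_derivative D (Suc n) x) (at x within S)"
    using assms unfolding smooth_fun_on_def by auto
  have "continuous_on S (D 0)"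
    using D(2) by (rule DERIV_continuous_on)
  then show ?thesis using D(1) by (simp cong: continuous_on_cong)
qed

lemma C1_imp_lipschitz_on_bounded:
  fixes u :: "real \<Rightarrow> real"
  assumes "\<And>x. (u has_real_derivative u' x) (at x)" "continuous_on UNIV u'"
  obtains M where "M-lipschitz_on {-R..R} u"
proof -
  have "bounded (u' ` {-R..R})"
    using assms(2) by (intro compact_imp_bounded compact_continuous_image)
      (auto intro: continuous_on_subset)
  then obtain M where M: "M > 0" "\<And>x. x \<in> {-R..R} \<Longrightarrow> norm (u' x) \<le> M"
    unfolding bounded_pos by blast
  have "M-lipschitz_on {-R..R} u"
  proof (rule lipschitz_onI)
    fix x y assume "x \<in> {-R..R}" "y \<in> {-R..R}"
    then have "norm (u x - u y) \<le> M * norm (x - y)"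
      by (intro field_differentiable_bound[of "{-R..R}" u u' M])
        (use M(2) in \<open>auto intro: assms(1) has_field_derivative_at_within\<close>)
    then show "dist (u x) (u y) \<le> M * dist x y"
      by (simp add: dist_norm)
  qed (use M in simp)
  then show thesis by (rule that)
qed

section \<open>Local existence and uniqueness backward in time\<close>

text \<open>The integral equation is solved by Banach's fixed point theorem. To work in the complete space
  of bounded continuous functions on the whole line, the time argument of the integral is clamped to
  \<open>{-T..0}\<close>, so that the iterates are constant outside this interval.\<close>

lemma picard_backward:
  fixes F :: "'a::euclidean_space \<Rightarrow> 'a"
  assumes lip: "L-lipschitz_on UNIV F"
  obtains T \<gamma> where "T > 0" "\<gamma> 0 = p"
    "\<And>t. t \<in> {-T..0} \<Longrightarrow> (\<gamma> has_vector_derivative F (\<gamma> t)) (at t within {-T..0})"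
proof -
  have L: "L \<ge> 0" using lip by (rule lipschitz_on_nonneg)
  \<comment> \<open>This choice makes \<open>T * L \<le> 1/2\<close>, the contraction constant; the summand \<open>1\<close> covers \<open>L = 0\<close>.\<close>
  define T where "T = 1 / (2 * (L + 1))"
  have T: "T > 0" "T * L \<le> 1/2" using L by (auto simp: T_def field_simps)
  define cl where "cl t = max (-T) (min 0 t)" for t :: real
  have cl: "cl t \<in> {-T..0}" for t using T by (auto simp: cl_def)
  have cl_id: "cl t = t" if "t \<in> {-T..0}" for t using that by (auto simp: cl_def)
  define I where "I u t = integral {-T..t} (\<lambda>s. F (apply_bcontfun u s))" for u :: "real \<Rightarrow>\<^sub>C 'a" and t
  have contF: "continuous_on S (\<lambda>s. F (apply_bcontfun u s))" for u :: "real \<Rightarrow>\<^sub>C 'a" and S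
    by (rule continuous_on_compose2[OF lipschitz_on_continuous_on[OF lip]])
      (auto intro: continuous_on_apply_bcontfun)
  have I_deriv: "(I u has_vector_derivative F (apply_bcontfun u t)) (at t within {-T..0})"
    if "t \<in> {-T..0}" for u t
    unfolding I_def using that by (intro integral_has_vector_derivative contF)
  have I_cont: "continuous_on {-T..0} (I u)" for u
    using I_deriv by (intro continuous_on_vector_derivative) auto
  \<comment> \<open>For \<open>t\<close> in \<open>{-T..0}\<close> this is \<open>p\<close> plus the integral of \<open>F \<circ> u\<close> from \<open>0\<close> back to \<open>t\<close>.\<close>
  define P where "P u t = p + (I u (cl t) - I u 0)" for u t
  have P_bc: "P u \<in> bcontfun" for u
  proof -
    have "bounded (I u ` {-T..0})"
      by (intro compact_imp_bounded compact_continuous_image I_cont) auto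
    then obtain B where B: "\<And>t. t \<in> {-T..0} \<Longrightarrow> norm (I u t) \<le> B"
      unfolding bounded_iff by blast
    have "norm (P u t) \<le> norm p + (B + norm (I u 0))" for t
      unfolding P_def using B[OF cl, of t] norm_triangle_ineq4[of "I u (cl t)" "I u 0"]
        norm_triangle_ineq[of p "I u (cl t) - I u 0"] by linarith
    moreover have "continuous_on UNIV (P u)"
      unfolding P_def using cl
      by (intro continuous_intros continuous_on_compose2[OF I_cont])
        (auto simp: cl_def[abs_def] intro!: continuous_intros)
    ultimately show ?thesis by (intro bcontfun_normI)
  qed
  define \<Phi> where "\<Phi> u = Bcontfun (P u)" for u
  have \<Phi>: "apply_bcontfun (\<Phi> u) = P u" for u
    unfolding \<Phi>_def by (simp add: Bcontfun_inverse P_bc)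
  have contraction: "dist (\<Phi> u) (\<Phi> v) \<le> (1/2) * dist u v" for u v
  proof (rule dist_bound)
    fix t
    let ?d = "\<lambda>s. F (apply_bcontfun u s) - F (apply_bcontfun v s)"
    have comb: "I w 0 = I w (cl t) + integral {cl t..0} (\<lambda>s. F (apply_bcontfun w s))" for w
      unfolding I_def using cl[of t]
      by (intro Henstock_Kurzweil_Integration.integral_combine[symmetric])
        (auto intro!: integrable_continuous_real contF)
    have "P v t - P u t = integral {cl t..0} (\<lambda>s. F (apply_bcontfun u s))
        - integral {cl t..0} (\<lambda>s. F (apply_bcontfun v s))"
      unfolding P_def by (simp add: comb)
    also have "\<dots> = integral {cl t..0} ?d"
      by (intro Henstock_Kurzweil_Integration.integral_diff[symmetric])
        (auto intro!: integrable_continuous_real contF)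
    also have "norm \<dots> \<le> (L * dist u v) * (0 - cl t)"
    proof (rule integral_bound)
      fix s
      have "dist (F (apply_bcontfun u s)) (F (apply_bcontfun v s))
          \<le> L * dist (apply_bcontfun u s) (apply_bcontfun v s)"
        using lip by (rule lipschitz_onD) auto
      also have "\<dots> \<le> L * dist u v"
        by (intro mult_left_mono L dist_bounded)
      finally show "norm (?d s) \<le> L * dist u v" by (simp add: dist_norm)
    qed (use cl[of t] in \<open>auto intro!: continuous_intros contF\<close>)
    also have "\<dots> \<le> (L * dist u v) * T"
      using cl[of t] L by (intro mult_left_mono) auto
    also have "\<dots> \<le> (1/2) * dist u v"
      using mult_right_mono[OF T(2), of "dist u v"] by (simp add: mult_ac)
    finally show "dist (apply_bcontfun (\<Phi> u) t) (apply_bcontfun (\<Phi> v) t) \<le> (1/2) * dist u v"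
      by (simp add: \<Phi> dist_norm norm_minus_commute)
  qed
  have "\<exists>!u. \<Phi> u = u"
    using contraction by (intro banach_fix_type[of "1/2"]) auto
  then obtain u where u: "\<Phi> u = u" by blast
  have u_eq: "apply_bcontfun u t = p + (I u (cl t) - I u 0)" for t
    using \<Phi>[of u] by (simp add: u P_def)
  show thesis
  proof (rule that[OF T(1)])
    show "apply_bcontfun u 0 = p" using u_eq[of 0] T cl_id[of 0] by simp
    fix t assume t: "t \<in> {-T..0}"
    have "((\<lambda>t. p + (I u t - I u 0)) has_vector_derivative F (apply_bcontfun u t))
        (at t within {-T..0})"
      using I_deriv[OF t, of u] by (auto intro!: derivative_eq_intros)
    then show "(apply_bcontfun u has_vector_derivative F (apply_bcontfun u t)) (at t within {-T..0})"
      by (rule has_vector_derivative_transform[rotated 2]) (use t in \<open>auto simp: u_eq cl_id\<close>)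
  qed
qed

text \<open>Composing \<open>F\<close> with the metric projection onto the ball, which is nonexpansive, gives a globally
  Lipschitz field. Its solution is one of \<open>F\<close> for as long as it stays in the ball.\<close>

lemma picard_backward_local:
  fixes F :: "'a::euclidean_space \<Rightarrow> 'a"
  assumes lip: "L-lipschitz_on (cball p r) F" and "r > 0"
  obtains T \<gamma> where "T > 0" "\<gamma> 0 = p"
    "\<And>t. t \<in> {-T..0} \<Longrightarrow> (\<gamma> has_vector_derivative F (\<gamma> t)) (at t within {-T..0})"
proof -
  let ?\<pi> = "closest_point (cball p r)"
  have \<pi>_in: "?\<pi> q \<in> cball p r" for q
    using \<open>r > 0\<close> by (intro closest_point_in_set) auto
  have "1-lipschitz_on UNIV ?\<pi>"
    using \<open>r > 0\<close> by (intro lipschitz_onI) (auto intro!: closest_point_lipschitz)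
  moreover have "L-lipschitz_on (?\<pi> ` UNIV) F"
    using lip by (rule lipschitz_on_subset) (use \<pi>_in in auto)
  ultimately have "(L * 1)-lipschitz_on UNIV (F \<circ> ?\<pi>)"
    by (rule lipschitz_on_compose)
  then obtain T \<gamma> where T: "T > 0" and \<gamma>0: "\<gamma> 0 = p" and
    \<gamma>: "\<And>t. t \<in> {-T..0} \<Longrightarrow> (\<gamma> has_vector_derivative (F \<circ> ?\<pi>) (\<gamma> t)) (at t within {-T..0})"
    using picard_backward[where p = p] by metis
  have "continuous_on {-T..0} \<gamma>"
    using \<gamma> by (intro continuous_on_vector_derivative) auto
  then obtain d where d: "d > 0" "\<And>t. t \<in> {-T..0} \<Longrightarrow> dist t 0 < d \<Longrightarrow> dist (\<gamma> t) (\<gamma> 0) < r"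
    unfolding continuous_on_iff using T \<open>r > 0\<close> by (metis atLeastAtMost_iff neg_le_0_iff_le order.refl less_imp_le)
  define T' where "T' = min T (d/2)"
  show thesis
  proof (rule that[of T' \<gamma>])
    show "T' > 0" using T d by (simp add: T'_def)
    fix t assume t: "t \<in> {-T'..0}"
    then have t': "t \<in> {-T..0}" "dist t 0 < d" using d(1) by (auto simp: T'_def dist_norm)
    then have "?\<pi> (\<gamma> t) = \<gamma> t"
      using d(2) \<gamma>0 by (intro closest_point_self) (auto simp: dist_commute less_imp_le)
    then have "(\<gamma> has_vector_derivative F (\<gamma> t)) (at t within {-T..0})"
      using \<gamma>[OF t'(1)] by simp
    then show "(\<gamma> has_vector_derivative F (\<gamma> t)) (at t within {-T'..0})"
      by (rule has_vector_derivative_within_subset) (auto simp: T'_def)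
  qed (rule \<gamma>0)
qed

text \<open>Gronwall's argument: both solutions stay in a ball on which \<open>F\<close> has a Lipschitz constant \<open>L\<close>, so
  the squared distance decreases at a rate of at most \<open>2 * L\<close> times itself. With the weight
  \<open>exp (2 * L * t)\<close> it is therefore nondecreasing. As it vanishes at time \<open>0\<close>, it vanishes before.\<close>

lemma backward_uniqueness:
  fixes F :: "'a::euclidean_space \<Rightarrow> 'a"
  assumes lip: "\<And>R. \<exists>L. L-lipschitz_on (cball 0 R) F"
    and cont: "continuous_on {-S..0} u" "continuous_on {-S..0} v"
    and u: "\<And>t. -S < t \<Longrightarrow> t < 0 \<Longrightarrow> (u has_vector_derivative F (u t)) (at t)"
    and v: "\<And>t. -S < t \<Longrightarrow> t < 0 \<Longrightarrow> (v has_vector_derivative F (v t)) (at t)"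
    and eq0: "u 0 = v 0"
    and t: "t \<in> {-S..0}"
  shows "u t = v t"
proof -
  have "bounded (u ` {-S..0} \<union> v ` {-S..0})"
    using cont by (intro compact_imp_bounded compact_Un compact_continuous_image) auto
  then obtain R where R: "\<And>x. x \<in> u ` {-S..0} \<union> v ` {-S..0} \<Longrightarrow> norm x \<le> R"
    unfolding bounded_iff by blast
  obtain L where L: "L-lipschitz_on (cball 0 R) F" using lip by blast
  define w where "w s = u s - v s" for s
  define E where "E s = exp (2 * L * s) * (w s \<bullet> w s)" for s
  have "E t \<le> E 0"
  proof (rule DERIV_nonneg_imp_increasing_open[of t 0 E])
    show "t \<le> 0" using t by simp
    show "continuous_on {t..0} E"
      unfolding E_def w_def using t
      by (intro continuous_intros continuous_on_subset[OF cont(1)] continuous_on_subset[OF cont(2)]) auto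
    fix s assume s: "t < s" "s < 0"
    then have s': "-S < s" "s < 0" "s \<in> {-S..0}" using t by auto
    let ?D = "F (u s) - F (v s)"
    have "(w has_vector_derivative ?D) (at s)"
      unfolding w_def using u v s' by (intro has_vector_derivative_diff) auto
    then have "((\<lambda>s. w s \<bullet> w s) has_derivative (\<lambda>h. w s \<bullet> (h *\<^sub>R ?D) + (h *\<^sub>R ?D) \<bullet> w s)) (at s)"
      unfolding has_vector_derivative_def by (intro has_derivative_inner)
    then have "((\<lambda>s. w s \<bullet> w s) has_real_derivative 2 * (w s \<bullet> ?D)) (at s)"
      unfolding has_field_derivative_def
      by (rule has_derivative_eq_rhs) (auto simp: fun_eq_iff inner_commute)
    then have der: "(E has_real_derivative exp (2 * L * s) * (2 * L * (w s \<bullet> w s) + 2 * (w s \<bullet> ?D))) (at s)"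
      unfolding E_def by (auto intro!: derivative_eq_intros simp: algebra_simps)
    have "norm ?D \<le> L * norm (w s)"
      using lipschitz_onD[OF L, of "u s" "v s"] R s'(3) by (simp add: dist_norm w_def)
    then have "norm (w s) * norm ?D \<le> L * (w s \<bullet> w s)"
      by (metis dot_square_norm mult.left_commute mult_left_mono norm_ge_zero power2_eq_square)
    moreover have "\<bar>w s \<bullet> ?D\<bar> \<le> norm (w s) * norm ?D" by (rule Cauchy_Schwarz_ineq2)
    ultimately have "0 \<le> 2 * L * (w s \<bullet> w s) + 2 * (w s \<bullet> ?D)" by linarith
    then show "\<exists>y. (E has_real_derivative y) (at s) \<and> 0 \<le> y"
      using der by (meson exp_ge_zero mult_nonneg_nonneg)
  qed
  moreover have "E 0 = 0" by (simp add: E_def w_def eq0)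
  moreover have "E t \<ge> 0" by (simp add: E_def)
  ultimately have "E t = 0" by linarith
  then show ?thesis by (simp add: E_def w_def)
qed

section \<open>The saddle of the smooth system\<close>

lemma lienard_field_nth [simp]:
  "lienard_field f G p $ 1 = p$2 - G (p$1)" "lienard_field f G p $ 2 = p$2 - f (p$1)"
  by (simp_all add: lienard_field_def)

lemma lienard_field_cong: "G (p$1) = H (p$1) \<Longrightarrow> lienard_field f G p = lienard_field f H p"
  by (simp add: lienard_field_def)

lemma saddle_lienard_field:
  assumes f: "(f has_real_derivative f') (at x)" and G: "(G has_real_derivative G') (at x)"
    and "G x = f x" "f' < G'"
  shows "saddle (lienard_field f G) (vector [x, f x])"
proof -
  let ?p = "vector [x, f x] :: real^2"
  let ?A = "\<lambda>v :: real^2. vector [v$2 - G' * v$1, v$2 - f' * v$1] :: real^2"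
  have nth: "((\<lambda>q. q $ i) has_derivative (\<lambda>v. v $ i)) (at ?p)" for i
    by (rule bounded_linear.has_derivative[OF bounded_linear_vec_nth has_derivative_ident])
  have comp: "((\<lambda>q. H (q$1)) has_derivative (\<lambda>v. H' * v$1)) (at ?p)"
    if "(H has_real_derivative H') (at x)" for H H'
    using has_derivative_compose[OF nth[of 1], of H "(*) H'"] that
    by (simp add: has_field_derivative_def)
  have "((\<lambda>q. lienard_field f G q $ 1) has_derivative (\<lambda>v. ?A v $ 1)) (at ?p)"
    using has_derivative_diff[OF nth[of 2] comp[OF G]] by simp
  moreover have "((\<lambda>q. lienard_field f G q $ 2) has_derivative (\<lambda>v. ?A v $ 2)) (at ?p)"
    using has_derivative_diff[OF nth[of 2] comp[OF f]] by simp
  ultimately have "((\<lambda>q. lienard_field f G q $ i) has_derivative (\<lambda>v. ?A v $ i)) (at ?p)" for i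
    using exhaust_2[of i] by (elim disjE) (simp_all only:)
  then have der: "(lienard_field f G has_derivative ?A) (at ?p)"
    by (subst has_derivative_componentwise_within) (auto simp: Basis_vec_def cart_eq_inner_axis[symmetric])
  then have "?A = frechet_derivative (lienard_field f G) (at ?p)"
    by (rule frechet_derivative_at)
  then have jac: "jacobian (lienard_field f G) (at ?p) = matrix ?A"
    by (simp only: jacobian_def)
  have "matrix ?A $ 1 $ 1 = - G'" "matrix ?A $ 1 $ 2 = 1" "matrix ?A $ 2 $ 1 = - f'" "matrix ?A $ 2 $ 2 = 1"
    by (simp_all add: matrix_def axis_def)
  then have "det (jacobian (lienard_field f G) (at ?p)) = f' - G'"
    unfolding jac det_2 by simp
  moreover have "lienard_field f G ?p = 0"
    using assms(3) by (simp add: vec_eq_iff forall_2)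
  ultimately show ?thesis
    unfolding saddle_def using differentiableI[OF der] assms(4) by simp
qed

text \<open>The equilibria are sought as \<open>x = a * \<xi>\<close> with \<open>\<xi>\<close> in the fixed compact interval around \<open>\<xi>\<^sub>0\<close>.
  There \<open>g'\<close> has a positive lower bound \<open>m\<close>, and for small \<open>a\<close> the points \<open>a * \<xi>\<close> lie in
  \<open>{-1..1}\<close>, where \<open>\<bar>f'\<bar>\<close> is bounded by some \<open>M\<close>. So \<open>a * M < m\<close> makes every such equilibrium a
  saddle.\<close>

lemma saddle_family:
  fixes f g :: "real \<Rightarrow> real"
  assumes f: "\<And>x. (f has_real_derivative f' x) (at x)" "continuous_on UNIV f'"
    and g: "\<And>x. (g has_real_derivative g' x) (at x)" "continuous_on UNIV g'"
    and g'_pos: "\<And>x. g' x > 0"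
    and root: "g \<xi>\<^sub>0 = f 0"
  shows "\<exists>p :: real \<Rightarrow> real^2.
    (\<forall>\<^sub>F a in at_right 0. saddle (lienard_field f (\<lambda>x. g (x / a))) (p a)) \<and>
    ((\<lambda>a. p a $ 1) \<longlongrightarrow> 0) (at_right 0)"
proof -
  let ?J = "{\<xi>\<^sub>0 - 1..\<xi>\<^sub>0 + 1}"
  have contf: "continuous_on S f" and contg: "continuous_on S g" for S
    using f(1) g(1) by (meson DERIV_isCont continuous_at_imp_continuous_on)+
  obtain m where m: "m > 0" "\<And>\<xi>. \<xi> \<in> ?J \<Longrightarrow> m \<le> g' \<xi>"
  proof -
    obtain z where "\<forall>\<xi>\<in>?J. g' z \<le> g' \<xi>"
      using continuous_attains_inf[of ?J g'] g(2) by (auto intro: continuous_on_subset)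
    then show thesis using that[of "g' z"] g'_pos by auto
  qed
  have "bounded (f' ` {-1..1})"
    using f(2) by (intro compact_imp_bounded compact_continuous_image)
      (auto intro: continuous_on_subset)
  then obtain M where M: "M > 0" "\<And>x. x \<in> {-1..1} \<Longrightarrow> \<bar>f' x\<bar> \<le> M"
    unfolding bounded_pos by (auto simp del: atLeastAtMost_iff)
  have g_mono: "g x < g y" if "x < y" for x y
    using that g'_pos g(1) by (intro DERIV_pos_imp_increasing[of x y g]) blast+
  have lim: "((\<lambda>a. f (a * \<xi>)) \<longlongrightarrow> f 0) (at_right 0)" for \<xi>
  proof -
    have "((\<lambda>a. a * \<xi>) \<longlongrightarrow> 0 * \<xi>) (at_right 0)" by (intro tendsto_intros)
    then show ?thesis
      using DERIV_isCont[OF f(1)] by (intro isCont_tendsto_compose[of 0 f]) auto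
  qed
  have ev: "\<forall>\<^sub>F a in at_right 0. \<exists>\<xi>\<in>?J. saddle (lienard_field f (\<lambda>x. g (x / a))) (vector [a * \<xi>, f (a * \<xi>)])"
  proof -
    have "\<forall>\<^sub>F a in at_right 0. f (a * (\<xi>\<^sub>0 + 1)) < g (\<xi>\<^sub>0 + 1)"
      using lim g_mono[of \<xi>\<^sub>0 "\<xi>\<^sub>0 + 1"] root by (intro order_tendstoD(2)) auto
    moreover have "\<forall>\<^sub>F a in at_right 0. g (\<xi>\<^sub>0 - 1) < f (a * (\<xi>\<^sub>0 - 1))"
      using lim g_mono[of "\<xi>\<^sub>0 - 1" \<xi>\<^sub>0] root by (intro order_tendstoD(1)) auto
    \<comment> \<open>The first bound gives \<open>\<bar>a * \<xi>\<bar> \<le> 1\<close> on \<open>?J\<close>, the second \<open>a * M < m\<close>.\<close>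
    moreover have "\<forall>\<^sub>F a in at_right 0. a < min (1 / (\<bar>\<xi>\<^sub>0\<bar> + 1)) (m / M)"
      using m(1) M(1) by (intro order_tendstoD(2)[OF tendsto_ident_at]) (auto simp: add_pos_nonneg)
    moreover have "\<forall>\<^sub>F a :: real in at_right 0. 0 < a" by (rule eventually_at_right_less)
    ultimately show ?thesis
    proof eventually_elim
      case (elim a)
      have "\<exists>\<xi>\<ge>\<xi>\<^sub>0 - 1. \<xi> \<le> \<xi>\<^sub>0 + 1 \<and> g \<xi> - f (a * \<xi>) = 0"
        using elim by (intro IVT')
          (auto intro!: continuous_intros contg continuous_on_compose2[OF contf[of UNIV]])
      then obtain \<xi> where \<xi>: "\<xi> \<in> ?J" "g \<xi> = f (a * \<xi>)" by auto
      have "a * (\<bar>\<xi>\<^sub>0\<bar> + 1) < 1" and aM: "a * M < m"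
        using elim M(1) by (auto simp: field_simps)
      moreover have "\<bar>a * \<xi>\<bar> \<le> a * (\<bar>\<xi>\<^sub>0\<bar> + 1)"
        using \<xi>(1) elim(4) by (auto simp: abs_mult intro!: mult_left_mono)
      ultimately have "\<bar>f' (a * \<xi>)\<bar> \<le> M" by (intro M) auto
      then have "a * f' (a * \<xi>) \<le> a * M" using elim(4) by (intro mult_left_mono) auto
      then have "a * f' (a * \<xi>) < g' \<xi>"
        using aM m(2)[OF \<xi>(1)] by linarith
      then have "f' (a * \<xi>) < g' \<xi> / a"
        using elim(4) by (simp add: pos_less_divide_eq mult.commute)
      moreover have "((\<lambda>x. g (x / a)) has_real_derivative g' (a * \<xi> / a) * (1 / a)) (at (a * \<xi>))"
        by (rule DERIV_chain2[OF g(1) DERIV_cdivide[OF DERIV_ident]])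
      then have "((\<lambda>x. g (x / a)) has_real_derivative g' \<xi> / a) (at (a * \<xi>))"
        using elim(4) by simp
      ultimately have "saddle (lienard_field f (\<lambda>x. g (x / a))) (vector [a * \<xi>, f (a * \<xi>)])"
        using f(1) \<xi>(2) elim(4) by (intro saddle_lienard_field) auto
      then show ?case using \<xi>(1) by blast
    qed
  qed
  define \<xi> where "\<xi> a = (SOME \<xi>. \<xi> \<in> ?J \<and>
    saddle (lienard_field f (\<lambda>x. g (x / a))) (vector [a * \<xi>, f (a * \<xi>)]))" for a
  have ev\<xi>: "\<forall>\<^sub>F a in at_right 0. \<xi> a \<in> ?J \<and>
      saddle (lienard_field f (\<lambda>x. g (x / a))) (vector [a * \<xi> a, f (a * \<xi> a)])"
    using ev by eventually_elim (unfold \<xi>_def, rule someI_ex, blast)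
  have "((\<lambda>a. a * \<xi> a) \<longlongrightarrow> 0) (at_right 0)"
  proof (rule Lim_null_comparison)
    show "\<forall>\<^sub>F a in at_right 0. norm (a * \<xi> a) \<le> \<bar>a\<bar> * (\<bar>\<xi>\<^sub>0\<bar> + 1)"
      using ev\<xi> by eventually_elim (auto simp: abs_mult intro!: mult_left_mono)
    have "((\<lambda>a. \<bar>a\<bar> * (\<bar>\<xi>\<^sub>0\<bar> + 1)) \<longlongrightarrow> \<bar>0\<bar> * (\<bar>\<xi>\<^sub>0\<bar> + 1)) (at_right 0)"
      by (intro tendsto_intros)
    then show "((\<lambda>a. \<bar>a\<bar> * (\<bar>\<xi>\<^sub>0\<bar> + 1)) \<longlongrightarrow> 0) (at_right 0)" by simp
  qed
  then show ?thesis
    using ev\<xi> by (intro exI[of _ "\<lambda>a. vector [a * \<xi> a, f (a * \<xi> a)]"])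
      (auto elim: eventually_mono)
qed

section \<open>The sliding flow\<close>

lemma norm_vector_0_left: "norm (vector [0, k] :: real^2) = \<bar>k\<bar>"
  by (simp add: norm_vec_def L2_set_def sum_2)

lemma sliding_fun_lienard:
  "sliding_fun (lienard_field f G) (lienard_field f H) q l
    = q$2 - (l * G (q$1) + (1 - l) * H (q$1))"
  by (simp add: sliding_fun_def convex_field_def switch_grad_def inner_vec_def sum_2 algebra_simps)

lemma convex_field_lienard_nth:
  "convex_field (lienard_field f G) (lienard_field f H) l q $ 1
    = sliding_fun (lienard_field f G) (lienard_field f H) q l"
  "convex_field (lienard_field f G) (lienard_field f H) l q $ 2 = q$2 - f (q$1)"
  by (simp_all add: sliding_fun_lienard convex_field_def algebra_simps)

lemma ex_convex_weight_iff:
  fixes m M y :: real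
  assumes "m < M"
  shows "(\<exists>l\<in>{0..1}. y = l * M + (1 - l) * m) \<longleftrightarrow> m \<le> y \<and> y \<le> M"
proof
  assume "\<exists>l\<in>{0..1}. y = l * M + (1 - l) * m"
  then obtain l where l: "0 \<le> l" "l \<le> 1" "y = l * M + (1 - l) * m" by auto
  have "y - m = l * (M - m)" "M - y = (1 - l) * (M - m)"
    using l(3) by (simp_all add: algebra_simps)
  moreover have "l * (M - m) \<ge> 0" "(1 - l) * (M - m) \<ge> 0" using l assms by simp_all
  ultimately show "m \<le> y \<and> y \<le> M" by linarith
next
  assume y: "m \<le> y \<and> y \<le> M"
  define l where "l = (y - m) / (M - m)"
  have "l * (M - m) = y - m" using assms by (simp add: l_def)
  then have "y = l * M + (1 - l) * m" by (simp add: algebra_simps)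
  moreover have "l \<in> {0..1}" using y assms by (simp add: l_def)
  ultimately show "\<exists>l\<in>{0..1}. y = l * M + (1 - l) * m" by blast
qed

lemma sliding_region_lienard:
  assumes "H 0 < G 0"
  shows "sliding_region (lienard_field f G) (lienard_field f H)
    = {q. q$1 = 0 \<and> H 0 \<le> q$2 \<and> q$2 \<le> G 0}"
  by (simp add: sliding_region_def switch_fun_def sliding_fun_lienard ex_convex_weight_iff[OF assms]
      cong: conj_cong)

lemma attracting_sliding_lienard:
  assumes "H 0 < G 0"
  shows "attracting_sliding (lienard_field f G) (lienard_field f H)"
  unfolding attracting_sliding_def
proof (intro ballI impI)
  fix q l assume "q \<in> sliding_region (lienard_field f G) (lienard_field f H)"
  then have q: "q$1 = 0" by (simp add: sliding_region_def switch_fun_def)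
  have "sliding_fun (lienard_field f G) (lienard_field f H) q = (\<lambda>l. q$2 - (l * G 0 + (1 - l) * H 0))"
    by (simp add: fun_eq_iff sliding_fun_lienard q)
  moreover have "((\<lambda>l. q$2 - (l * G 0 + (1 - l) * H 0)) has_real_derivative H 0 - G 0) (at l)"
    by (auto intro!: derivative_eq_intros)
  ultimately show "deriv (sliding_fun (lienard_field f G) (lienard_field f H) q) l < 0"
    using assms by (simp add: DERIV_imp_deriv)
qed

lemma pseudoequilibrium_lienard:
  assumes "H 0 < f 0" "f 0 < G 0"
  shows "pseudoequilibrium (lienard_field f G) (lienard_field f H) (vector [0, f 0])"
proof -
  let ?p = "vector [0, f 0] :: real^2"
  obtain l where "l \<in> {0..1}" "f 0 = l * G 0 + (1 - l) * H 0"
    using ex_convex_weight_iff[of "H 0" "G 0" "f 0"] assms by auto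
  moreover from this have "convex_field (lienard_field f G) (lienard_field f H) l ?p = 0"
    by (simp add: vec_eq_iff forall_2 convex_field_lienard_nth sliding_fun_lienard)
  moreover have "lienard_field f G ?p $ 1 \<noteq> 0" "lienard_field f H ?p $ 1 \<noteq> 0"
    using assms by simp_all
  then have "lienard_field f G ?p \<noteq> 0" "lienard_field f H ?p \<noteq> 0"
    by (metis zero_index)+
  moreover have "switch_fun ?p = 0" by (simp add: switch_fun_def)
  ultimately show ?thesis
    unfolding pseudoequilibrium_def by blast
qed

text \<open>The convex combination affects only the first component of the field, since the two fields
  have the same second component. Sliding thus follows \<open>y' = y - f 0\<close> whatever the weight \<open>l\<close> is, and
  \<open>l\<close> only has to make the first component vanish, which is possible within the segment.\<close>

lemma exponential_sliding_solution:
  assumes "H 0 < G 0" and "\<And>t. t \<in> I \<Longrightarrow> f 0 + exp t * k \<in> {H 0..G 0}"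
  shows "sliding_solution (lienard_field f G) (lienard_field f H)
    (\<lambda>t. vector [0, f 0] + exp t *\<^sub>R vector [0, k]) I"
  unfolding sliding_solution_def
proof (intro ballI conjI)
  fix t assume t: "t \<in> I"
  let ?\<phi> = "\<lambda>t. vector [0, f 0] + exp t *\<^sub>R vector [0, k] :: real^2"
  show "switch_fun (?\<phi> t) = 0" by (simp add: switch_fun_def)
  obtain l where l: "l \<in> {0..1}" "f 0 + exp t * k = l * G 0 + (1 - l) * H 0"
    using ex_convex_weight_iff[OF assms(1), of "f 0 + exp t * k"] assms(2)[OF t] by auto
  have "(?\<phi> has_vector_derivative exp t *\<^sub>R vector [0, k]) (at t within I)"
    by (auto intro!: derivative_eq_intros)
  moreover have "exp t *\<^sub>R vector [0, k] = convex_field (lienard_field f G) (lienard_field f H) l (?\<phi> t)"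
    using l(2) by (simp add: vec_eq_iff forall_2 convex_field_lienard_nth sliding_fun_lienard)
  ultimately show "\<exists>l\<in>{0..1}. sliding_fun (lienard_field f G) (lienard_field f H) (?\<phi> t) l = 0 \<and>
      (?\<phi> has_vector_derivative convex_field (lienard_field f G) (lienard_field f H) l (?\<phi> t)) (at t within I)"
    using l by (intro bexI[of _ l]) (auto simp: sliding_fun_lienard)
qed

lemma sliding_solution_is_exponential:
  assumes sol: "sliding_solution (lienard_field f G) (lienard_field f H) \<phi> I"
    and "convex I" "0 \<in> I" "t \<in> I"
  shows "\<phi> t = vector [0, f 0] + exp t *\<^sub>R vector [0, \<phi> 0 $ 2 - f 0]"
proof -
  let ?w = "\<lambda>t. (\<phi> t $ 2 - f 0) * exp (- t)"
  have on_line: "\<phi> s $ 1 = 0" if "s \<in> I" for s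
    using sol that by (simp add: sliding_solution_def switch_fun_def)
  have "(?w has_real_derivative 0) (at s within I)" if s: "s \<in> I" for s
  proof -
    obtain l where "(\<phi> has_vector_derivative
        convex_field (lienard_field f G) (lienard_field f H) l (\<phi> s)) (at s within I)"
      using sol s unfolding sliding_solution_def by blast
    then have "((\<lambda>s. \<phi> s $ 2) has_vector_derivative
        convex_field (lienard_field f G) (lienard_field f H) l (\<phi> s) $ 2) (at s within I)"
      by (rule bounded_linear.has_vector_derivative[OF bounded_linear_vec_nth])
    then have "((\<lambda>s. \<phi> s $ 2) has_real_derivative \<phi> s $ 2 - f 0) (at s within I)"
      by (simp add: has_real_derivative_iff_has_vector_derivative convex_field_lienard_nth on_line[OF s])
    then show ?thesis
      by (auto intro!: derivative_eq_intros simp: algebra_simps)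
  qed
  \<comment> \<open>The integrating factor \<open>exp (- t)\<close> turns \<open>y - f 0\<close> into a constant of motion.\<close>
  then obtain c where "\<And>s. s \<in> I \<Longrightarrow> ?w s = c"
    using has_field_derivative_zero_constant[OF \<open>convex I\<close>, of ?w] by blast
  then have "?w t = ?w 0" using assms(3,4) by metis
  then have "\<phi> t $ 2 = f 0 + exp t * (\<phi> 0 $ 2 - f 0)"
    by (simp add: exp_minus field_simps)
  then show ?thesis
    using on_line[OF \<open>t \<in> I\<close>] by (simp add: vec_eq_iff forall_2)
qed

text \<open>Upward from \<open>f 0\<close> the room inside the sliding region is \<open>G 0 - f 0\<close>, and a solution starting
  at any small height \<open>k > 0\<close> above \<open>f 0\<close> reaches the upper end, at time \<open>ln ((G 0 - f 0) / k)\<close>.\<close>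

lemma not_sliding_stable_lienard:
  assumes "H 0 < f 0" "f 0 < G 0"
  shows "\<not> sliding_stable (lienard_field f G) (lienard_field f H) (vector [0, f 0])"
proof
  let ?p = "vector [0, f 0] :: real^2"
  define \<epsilon> where "\<epsilon> = G 0 - f 0"
  have \<epsilon>: "\<epsilon> > 0" using assms by (simp add: \<epsilon>_def)
  assume "sliding_stable (lienard_field f G) (lienard_field f H) ?p"
  then obtain \<delta> where \<delta>: "\<delta> > 0" and stable:
    "\<And>T \<phi>. \<lbrakk>T \<ge> 0; sliding_solution (lienard_field f G) (lienard_field f H) \<phi> {0..T};
        dist (\<phi> 0) ?p < \<delta>\<rbrakk> \<Longrightarrow> \<forall>t\<in>{0..T}. dist (\<phi> t) ?p < \<epsilon>"
    unfolding sliding_stable_def using \<epsilon> by meson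
  define k where "k = min (\<delta> / 2) \<epsilon>"
  have k: "0 < k" "k < \<delta>" "k \<le> \<epsilon>" using \<delta> \<epsilon> by (auto simp: k_def)
  define T where "T = ln (\<epsilon> / k)"
  have T: "T \<ge> 0" "exp T * k = \<epsilon>" using k \<epsilon> by (auto simp: T_def)
  let ?\<phi> = "\<lambda>t. ?p + exp t *\<^sub>R vector [0, k]"
  have dist: "dist (?\<phi> t) ?p = exp t * k" for t
    using k(1) by (simp add: dist_norm norm_vector_0_left)
  have "sliding_solution (lienard_field f G) (lienard_field f H) ?\<phi> {0..T}"
  proof (rule exponential_sliding_solution)
    fix t assume "t \<in> {0..T}"
    then have "exp t * k \<le> exp T * k" using k(1) by (intro mult_right_mono) auto
    moreover have "exp t * k > 0" using k(1) by simp
    ultimately show "f 0 + exp t * k \<in> {H 0..G 0}"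
      using T(2) assms by (auto simp: \<epsilon>_def)
  qed (use assms in simp)
  then have "dist (?\<phi> T) ?p < \<epsilon>"
    using stable[of T ?\<phi>] T(1) dist[of 0] k(2) by auto
  then show False using dist[of T] T(2) by simp
qed

text \<open>Backward in time \<open>k * exp t\<close> shrinks from \<open>k\<close> to \<open>0\<close>, so a solution starting in the segment
  remains in it for all negative times.\<close>

lemma local_unstable_manifold_lienard:
  assumes "H 0 < f 0" "f 0 < G 0"
  shows "local_unstable_manifold (lienard_field f G) (lienard_field f H) (vector [0, f 0])
    {q. q$1 = 0 \<and> H 0 < q$2 \<and> q$2 < G 0}"
    (is "local_unstable_manifold ?Fp ?Fm ?p ?U")
  unfolding local_unstable_manifold_def
proof (intro conjI ballI allI impI)
  show "?p \<in> ?U" using assms by simp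
  have "open {q :: real^2. H 0 < q$2 \<and> q$2 < G 0}"
    by (intro open_Collect_conj open_Collect_less continuous_intros)
  moreover have "?U = sliding_region ?Fp ?Fm \<inter> {q. H 0 < q$2 \<and> q$2 < G 0}"
    using assms by (auto simp: sliding_region_lienard)
  ultimately show "openin (top_of_set (sliding_region ?Fp ?Fm)) ?U"
    by (simp only: openin_open_Int)
  have "?U = (\<lambda>y. y *\<^sub>R vector [0, 1]) ` {H 0<..<G 0}"
    by (auto simp: image_iff vec_eq_iff forall_2)
  then show "connected ?U"
    by (auto intro!: connected_continuous_image continuous_intros)
next
  fix q assume q: "q \<in> ?U"
  let ?k = "q$2 - f 0"
  have "sliding_solution ?Fp ?Fm (\<lambda>t. ?p + exp t *\<^sub>R vector [0, ?k]) {..0}"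
  proof (rule exponential_sliding_solution)
    fix t :: real assume "t \<in> {..0}"
    then have "\<bar>exp t * ?k\<bar> \<le> 1 * \<bar>?k\<bar>"
      unfolding abs_mult by (intro mult_right_mono) auto
    then have "\<bar>exp t * ?k\<bar> \<le> \<bar>?k\<bar>" by simp
    moreover have "0 \<le> ?k \<and> 0 \<le> exp t * ?k \<or> ?k \<le> 0 \<and> exp t * ?k \<le> 0"
      by (simp add: zero_le_mult_iff mult_le_0_iff) linarith
    moreover have "H 0 < q$2" "q$2 < G 0" using q by simp_all
    ultimately show "f 0 + exp t * ?k \<in> {H 0..G 0}"
      using assms unfolding atLeastAtMost_iff by (elim disjE conjE) (intro conjI; linarith)+
  qed (use assms in simp)
  moreover have "?p + exp 0 *\<^sub>R vector [0, ?k] = q"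
    using q by (simp add: vec_eq_iff forall_2)
  ultimately show "\<exists>\<phi>. sliding_solution ?Fp ?Fm \<phi> {..0} \<and> \<phi> 0 = q" by blast
next
  fix q \<phi> assume "sliding_solution ?Fp ?Fm \<phi> {..0} \<and> \<phi> 0 = q"
  then have "\<phi> t = ?p + exp t *\<^sub>R vector [0, q$2 - f 0]" if "t \<le> 0" for t
    using sliding_solution_is_exponential[of f G H \<phi> "{..0}" t] that by auto
  then have "\<forall>\<^sub>F t in at_bot. ?p + exp t *\<^sub>R vector [0, q$2 - f 0] = \<phi> t"
    by (intro eventually_mono[OF eventually_le_at_bot[of "0::real"]]) simp
  moreover have "((\<lambda>t::real. ?p + exp t *\<^sub>R vector [0, q$2 - f 0]) \<longlongrightarrow> ?p + 0 *\<^sub>R vector [0, q$2 - f 0]) at_bot"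
    by (intro tendsto_intros exp_at_bot)
  ultimately have "(\<phi> \<longlongrightarrow> ?p + 0 *\<^sub>R vector [0, q$2 - f 0]) at_bot"
    by (rule Lim_transform_eventually[rotated])
  then show "(\<phi> \<longlongrightarrow> ?p) at_bot" by simp
qed

section \<open>The trajectories arriving from the two sides\<close>

lemma lienard_field_lipschitz_on_cball:
  assumes "M-lipschitz_on {-R..R} f"
  shows "(2 + M)-lipschitz_on (cball 0 R) (lienard_field f (\<lambda>_. c))"
proof (rule lipschitz_onI)
  have M: "M \<ge> 0" using assms by (rule lipschitz_on_nonneg)
  then show "0 \<le> 2 + M" by simp
  fix p q :: "real^2" assume "p \<in> cball 0 R" "q \<in> cball 0 R"
  then have "p$1 \<in> {-R..R}" "q$1 \<in> {-R..R}"
    using component_le_norm_cart[of p 1] component_le_norm_cart[of q 1] by auto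
  then have f: "\<bar>f (p$1) - f (q$1)\<bar> \<le> M * \<bar>(p - q)$1\<bar>"
    using lipschitz_onD[OF assms] by (simp add: dist_real_def)
  have "norm (lienard_field f (\<lambda>_. c) p - lienard_field f (\<lambda>_. c) q)
      \<le> \<bar>(p - q)$2\<bar> + \<bar>(p - q)$2 - (f (p$1) - f (q$1))\<bar>"
    using norm_le_l1_cart[of "lienard_field f (\<lambda>_. c) p - lienard_field f (\<lambda>_. c) q"]
    by (simp add: sum_2 algebra_simps)
  also have "\<dots> \<le> 2 * \<bar>(p - q)$2\<bar> + M * \<bar>(p - q)$1\<bar>"
    using f by linarith
  also have "\<dots> \<le> 2 * norm (p - q) + M * norm (p - q)"
    using M by (intro add_mono mult_left_mono component_le_norm_cart) auto
  finally show "dist (lienard_field f (\<lambda>_. c) p) (lienard_field f (\<lambda>_. c) q) \<le> (2 + M) * dist p q"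
    by (simp add: dist_norm algebra_simps)
qed

text \<open>The sign \<open>s = 1\<close> selects the right half-plane and \<open>s = -1\<close> the left one. There the field agrees
  with \<open>lienard_field f (\<lambda>_. c)\<close>, which is locally Lipschitz on the whole plane and so has a unique
  backward solution from the pseudoequilibrium. Near this point \<open>s * x\<close> has a derivative close to
  \<open>s * (f 0 - c) < 0\<close>; since it is \<open>0\<close> on arrival, it was positive before.\<close>

lemma ex_unique_arriving_trajectory:
  fixes f G :: "real \<Rightarrow> real"
  assumes f_lip: "\<And>R. \<exists>M. M-lipschitz_on {-R..R} f"
    and G: "\<And>x. 0 < s * x \<Longrightarrow> G x = c"
    and sign: "s * (f 0 - c) < 0"
  shows "\<exists>T \<gamma>. unique_arriving_trajectory (lienard_field f G) {q. 0 < s * switch_fun q}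
    (vector [0, f 0]) T \<gamma>"
proof -
  let ?p = "vector [0, f 0] :: real^2" and ?A = "{q. 0 < s * switch_fun q}"
  let ?F = "lienard_field f (\<lambda>_. c)"
  have F_lip: "\<exists>L. L-lipschitz_on (cball 0 R) ?F" for R
    using f_lip lienard_field_lipschitz_on_cball by blast
  have F_eq: "lienard_field f G q = ?F q" if "q \<in> ?A" for q
    using that by (intro lienard_field_cong G) (simp add: switch_fun_def)
  obtain L where "L-lipschitz_on (cball 0 (norm ?p + 1)) ?F" using F_lip by blast
  moreover have "cball ?p 1 \<subseteq> cball 0 (norm ?p + 1)"
    by (simp add: cball_subset_cball_iff)
  ultimately have "L-lipschitz_on (cball ?p 1) ?F" by (rule lipschitz_on_subset)
  then obtain T\<^sub>0 \<gamma> where T0: "T\<^sub>0 > 0" and \<gamma>0: "\<gamma> 0 = ?p" and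
    \<gamma>: "\<And>t. t \<in> {-T\<^sub>0..0} \<Longrightarrow> (\<gamma> has_vector_derivative ?F (\<gamma> t)) (at t within {-T\<^sub>0..0})"
    using picard_backward_local[of L ?p 1] by (metis zero_less_one)
  have cont0: "continuous_on {-T\<^sub>0..0} \<gamma>"
    using \<gamma> by (intro continuous_on_vector_derivative) auto
  have "continuous_on {-T\<^sub>0..0} (\<lambda>t. s * (\<gamma> t $ 2 - c))"
    by (intro continuous_intros cont0)
  moreover have "0 \<in> {-T\<^sub>0..0}" "- (s * (f 0 - c)) > 0" using T0 sign by auto
  \<comment> \<open>Within \<open>\<bar>s * (f 0 - c)\<bar>\<close> of its value at time \<open>0\<close>, the derivative of \<open>s * x\<close> stays negative.\<close>
  ultimately obtain d where d: "d > 0" and near: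
    "\<And>t. t \<in> {-T\<^sub>0..0} \<Longrightarrow> dist t 0 < d \<Longrightarrow>
      dist (s * (\<gamma> t $ 2 - c)) (s * (\<gamma> 0 $ 2 - c)) < - (s * (f 0 - c))"
    unfolding continuous_on_iff by metis
  define T where "T = min T\<^sub>0 (d / 2)"
  have T: "T > 0" "T \<le> T\<^sub>0" "T < d" using T0 d by (auto simp: T_def)
  have x_speed: "s * (\<gamma> t $ 2 - c) < 0" if "t \<in> {-T..0}" for t
    using near[of t] that T by (auto simp: \<gamma>0 dist_real_def)
  have cont: "continuous_on {-T..0} \<gamma>"
    using cont0 by (rule continuous_on_subset) (use T in auto)
  have \<gamma>_at: "(\<gamma> has_vector_derivative ?F (\<gamma> t)) (at t)" if "-T < t" "t < 0" for t
    using \<gamma>[of t] that T by (simp add: at_within_Icc_at)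
  have in_A: "\<gamma> t \<in> ?A" if t: "t \<in> {-T..<0}" for t
  proof -
    have "s * \<gamma> 0 $ 1 < s * \<gamma> t $ 1"
    proof (rule DERIV_neg_imp_decreasing_open[of t 0 "\<lambda>t. s * \<gamma> t $ 1"])
      show "t < 0" using t by simp
      show "continuous_on {t..0} (\<lambda>t. s * \<gamma> t $ 1)"
        using t by (intro continuous_intros continuous_on_subset[OF cont]) auto
      fix r assume r: "t < r" "r < 0"
      then have "((\<lambda>t. \<gamma> t $ 1) has_vector_derivative ?F (\<gamma> r) $ 1) (at r)"
        using \<gamma>_at t by (intro bounded_linear.has_vector_derivative[OF bounded_linear_vec_nth]) auto
      then have "((\<lambda>t. \<gamma> t $ 1) has_real_derivative \<gamma> r $ 2 - c) (at r)"
        by (simp add: has_real_derivative_iff_has_vector_derivative)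
      then have "((\<lambda>t. s * \<gamma> t $ 1) has_real_derivative s * (\<gamma> r $ 2 - c)) (at r)"
        by (rule DERIV_cmult)
      then show "\<exists>y. ((\<lambda>t. s * \<gamma> t $ 1) has_real_derivative y) (at r) \<and> y < 0"
        using x_speed[of r] r t by auto
    qed
    then show ?thesis by (simp add: \<gamma>0 switch_fun_def)
  qed
  have "arriving_trajectory (lienard_field f G) ?A ?p T \<gamma>"
    unfolding arriving_trajectory_def
  proof (intro conjI ballI)
    fix t assume t: "t \<in> {-T..<0}"
    then have "(\<gamma> has_vector_derivative ?F (\<gamma> t)) (at t within {-T\<^sub>0..0})"
      using T by (intro \<gamma>) auto
    then show "(\<gamma> has_vector_derivative lienard_field f G (\<gamma> t)) (at t within {-T..<0})"
      unfolding F_eq[OF in_A[OF t]]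
      by (rule has_vector_derivative_within_subset) (use T in auto)
  qed (use T cont \<gamma>0 in_A in auto)
  moreover have "\<gamma>' t = \<gamma> t"
    if arr: "arriving_trajectory (lienard_field f G) ?A ?p T' \<gamma>'" and t: "t \<in> {- min T T'..0}"
    for T' \<gamma>' t
  proof (rule backward_uniqueness[OF F_lip _ _ _ _ _ t])
    show "continuous_on {- min T T'..0} \<gamma>'"
      using arr unfolding arriving_trajectory_def
      by (elim conjE continuous_on_subset) auto
    show "continuous_on {- min T T'..0} \<gamma>"
      using cont by (rule continuous_on_subset) auto
    show "\<gamma>' 0 = \<gamma> 0" using arr \<gamma>0 by (simp add: arriving_trajectory_def)
    fix r assume r: "- min T T' < r" "r < 0"
    show "(\<gamma> has_vector_derivative ?F (\<gamma> r)) (at r)" using r by (intro \<gamma>_at) auto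
    have r': "r \<in> {-T'..<0}" using r by auto
    have "(\<gamma>' has_vector_derivative lienard_field f G (\<gamma>' r)) (at r within {-T'..<0})"
      and "\<gamma>' r \<in> ?A"
      using arr r' unfolding arriving_trajectory_def by blast+
    then have "(\<gamma>' has_vector_derivative ?F (\<gamma>' r)) (at r within {-T'<..<0})"
      unfolding F_eq[OF \<open>\<gamma>' r \<in> ?A\<close>] by (elim has_vector_derivative_within_subset) auto
    then show "(\<gamma>' has_vector_derivative ?F (\<gamma>' r)) (at r)"
      using r at_within_open[of r "{-T'<..<0}"] by simp
  qed
  ultimately show ?thesis unfolding unique_arriving_trajectory_def by blast
qed

section \<open>The limit of the scaled nonlinearity\<close>

text \<open>At \<open>x = 1\<close> the hypothesis says that \<open>h\<close> tends to \<open>u 1\<close> at infinity. As \<open>x / a\<close> tends to infinity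
  for every \<open>x > 0\<close>, the limit \<open>u x\<close> is the same for all these \<open>x\<close>, and by continuity for \<open>x = 0\<close>.\<close>

lemma scaling_limit_constant:
  fixes h u :: "real \<Rightarrow> real"
  assumes lim: "\<And>x. x > 0 \<Longrightarrow> ((\<lambda>a. h (x / a)) \<longlongrightarrow> u x) (at_right 0)"
    and cont: "continuous_on {0..} u"
  shows "x \<ge> 0 \<Longrightarrow> u x = u 0" and "(h \<longlongrightarrow> u 0) at_top"
proof -
  have h: "(h \<longlongrightarrow> u 1) at_top"
    using lim[of 1] by (simp add: filterlim_at_top_to_right inverse_eq_divide)
  have pos: "u x = u 1" if "x > 0" for x
  proof -
    have "filterlim (\<lambda>a. x / a) at_top (at_right 0)"
      using filterlim_tendsto_pos_mult_at_top[OF tendsto_const that filterlim_inverse_at_top_right]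
      by (simp add: divide_inverse)
    then have "((\<lambda>a. h (x / a)) \<longlongrightarrow> u 1) (at_right 0)"
      by (rule filterlim_compose[OF h])
    then show ?thesis
      using tendsto_unique[OF _ lim[OF that]] by simp
  qed
  have "(u \<longlongrightarrow> u 0) (at 0 within {0..})"
    using cont by (simp add: continuous_on_def)
  then have "(u \<longlongrightarrow> u 0) (at_right 0)"
    by (rule tendsto_within_subset) auto
  moreover have "(u \<longlongrightarrow> u 1) (at_right 0)"
    by (rule tendsto_eventually, rule eventually_mono[OF eventually_at_right_less]) (rule pos)
  ultimately have u0: "u 0 = u 1"
    using tendsto_unique[of "at_right (0::real)"] by simp
  show "x \<ge> 0 \<Longrightarrow> u x = u 0" using pos u0 by (metis order_le_less)
  show "(h \<longlongrightarrow> u 0) at_top" using h u0 by simp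
qed

theorem theorem3p1:
  fixes f g gp gm :: "real \<Rightarrow> real"
  assumes "smooth_fun_on UNIV f"
    and "smooth_fun_on UNIV g"
    and "\<forall>\<xi>. deriv g \<xi> > 0"
    and "smooth_fun_on {0..} gp"
    and "smooth_fun_on {..0} gm"
    and "\<forall>x. x \<noteq> 0 \<longrightarrow>
           ((\<lambda>a. g (x / a)) \<longlongrightarrow> (if x > 0 then gp x else gm x)) (at_right 0)"
    and "gm 0 < f 0" and "f 0 < gp 0"
  shows "(\<exists>p :: real \<Rightarrow> real^2.
            (\<forall>\<^sub>F a in at_right 0. saddle (lienard_field f (\<lambda>x. g (x / a))) (p a)) \<and>
            ((\<lambda>a. p a $ 1) \<longlongrightarrow> 0) (at_right 0)) \<and>
         (let Fp = lienard_field f gp; Fm = lienard_field f gm in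
            \<exists>p. pseudoequilibrium Fp Fm p \<and>
                p \<in> sliding_region Fp Fm \<and> attracting_sliding Fp Fm \<and>
                \<not> sliding_stable Fp Fm p \<and>
                (\<exists>U. local_unstable_manifold Fp Fm p U) \<and>
                (\<exists>W. local_stable_manifold Fp Fm p W))"
proof (rule conjI)
  obtain f' where f: "\<And>x. (f has_real_derivative f' x) (at x)" "continuous_on UNIV f'"
    using smooth_fun_on_UNIV_C1[OF assms(1)] by blast
  obtain g' where g: "\<And>x. (g has_real_derivative g' x) (at x)" "continuous_on UNIV g'"
    using smooth_fun_on_UNIV_C1[OF assms(2)] by blast
  have g'_pos: "g' x > 0" for x
    using assms(3) DERIV_imp_deriv[OF g(1)] by metis
  have gp: "continuous_on {0..} gp"
    using assms(4) by (rule smooth_fun_on_imp_continuous_on)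
  have gm: "continuous_on {0..} (\<lambda>x. gm (- x))"
    by (rule continuous_on_compose2[OF smooth_fun_on_imp_continuous_on[OF assms(5)]])
      (auto intro!: continuous_intros)
  have lim_p: "((\<lambda>a. g (x / a)) \<longlongrightarrow> gp x) (at_right 0)" if "x > 0" for x
    using assms(6)[rule_format, of x] that by simp
  have lim_m: "((\<lambda>a. g (- (x / a))) \<longlongrightarrow> gm (- x)) (at_right 0)" if "x > 0" for x
    using assms(6)[rule_format, of "-x"] that by simp
  \<comment> \<open>The left half-line is the right one for the reflected functions.\<close>
  note gp_const = scaling_limit_constant[of g gp, OF lim_p gp]
    and gm_const = scaling_limit_constant[of "\<lambda>y. g (- y)" "\<lambda>x. gm (- x)", OF lim_m gm]
  obtain \<xi>\<^sub>0 where "g \<xi>\<^sub>0 = f 0"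
  proof -
    have "\<forall>\<^sub>F y in at_top. f 0 < g y \<and> g (- y) < f 0 \<and> 0 \<le> y"
      using order_tendstoD(1)[OF gp_const(2) assms(8)] order_tendstoD(2)[OF gm_const(2), of "f 0"]
        eventually_ge_at_top[of "0::real"] assms(7)
      by (simp add: eventually_conj_iff)
    then obtain y where "f 0 < g y" "g (- y) < f 0" "0 \<le> y"
      using eventually_happens'[OF trivial_limit_at_top_linorder] by blast
    then have "\<exists>\<xi>\<ge>-y. \<xi> \<le> y \<and> g \<xi> = f 0"
      using DERIV_isCont[OF g(1)] by (intro IVT') (auto intro: continuous_at_imp_continuous_on)
    then show thesis using that by blast
  qed
  then show "\<exists>p :: real \<Rightarrow> real^2.
      (\<forall>\<^sub>F a in at_right 0. saddle (lienard_field f (\<lambda>x. g (x / a))) (p a)) \<and>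
      ((\<lambda>a. p a $ 1) \<longlongrightarrow> 0) (at_right 0)"
    by (rule saddle_family[OF f g g'_pos])
  have f_lip: "\<exists>M. M-lipschitz_on {-R..R} f" for R
    using C1_imp_lipschitz_on_bounded[OF f] by blast
  let ?p = "vector [0, f 0] :: real^2"
  have "gm x = gm 0" if "x < 0" for x
    using gm_const(1)[of "-x"] that by simp
  then obtain Tm \<gamma>m where left:
    "unique_arriving_trajectory (lienard_field f gm) {q. switch_fun q < 0} ?p Tm \<gamma>m"
    using ex_unique_arriving_trajectory[OF f_lip, of "-1" gm "gm 0"] assms(7) by auto
  have "gp x = gp 0" if "x > 0" for x
    using gp_const(1)[of x] that by simp
  then obtain Tp \<gamma>p where right:
    "unique_arriving_trajectory (lienard_field f gp) {q. switch_fun q > 0} ?p Tp \<gamma>p"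
    using ex_unique_arriving_trajectory[OF f_lip, of 1 gp "gp 0"] assms(8) by auto
  have order: "gm 0 < gp 0" using assms(7,8) by simp
  have "\<exists>W. local_stable_manifold (lienard_field f gp) (lienard_field f gm) ?p W"
    unfolding local_stable_manifold_def using left right by blast
  moreover have "?p \<in> sliding_region (lienard_field f gp) (lienard_field f gm)"
    using assms(7,8) by (simp add: sliding_region_lienard[of gm gp, OF order])
  ultimately show "let Fp = lienard_field f gp; Fm = lienard_field f gm in
      \<exists>p. pseudoequilibrium Fp Fm p \<and>
          p \<in> sliding_region Fp Fm \<and> attracting_sliding Fp Fm \<and>
          \<not> sliding_stable Fp Fm p \<and>
          (\<exists>U. local_unstable_manifold Fp Fm p U) \<and>
          (\<exists>W. local_stable_manifold Fp Fm p W)"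
    unfolding Let_def
    using pseudoequilibrium_lienard[of gm f gp] attracting_sliding_lienard[of gm gp f, OF order]
      not_sliding_stable_lienard[of gm f gp] local_unstable_manifold_lienard[of gm f gp] assms(7,8)
    by blast
qed

end
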